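(* Let $a\in L_1(0,2\pi)$ be real-valued with flux $\alpha=\frac1{2\pi}\int_0^{2\pi}a\,dx\notin\mathbb Z$. Let $\{\phi_n\}_{n=1}^N$ be $2\pi$-periodic vector-functions $\phi_n=(\phi_n(\cdot,1),\dots,\phi_n(\cdot,M))^T$ orthonormal in $L_2(0,2\pi;\mathbb C^M)$ (no zero-average condition), and $U(x,y)=\sum_{n=1}^N\phi_n(x)\overline{\phi_n(y)}^T$. Then $$\int_0^{2\pi}\operatorname{Tr}[U(x,x)^3]dx\le K(\alpha)^2\sum_{n=1}^N\sum_{j=1}^M\int_0^{2\pi}|(i\partial_x-a(x))\phi_n(x,j)|^2dx,$$ where $K(\alpha)=|\sin(2\pi\alpha)|^{-1}$ if $\alpha\bmod1\in(0,1/4)\cup(3/4,1)$ and $K(\alpha)=1$ if $\alpha\bmod1\in[1/4,3/4]$. *)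

theory Defs
  imports "HOL-Analysis.Analysis"
begin

definition Kconst :: "real \<Rightarrow> real" where
  "Kconst \<alpha> = (if 1/4 \<le> frac \<alpha> \<and> frac \<alpha> \<le> 3/4 then 1
                 else 1 / \<bar>sin (2 * pi * \<alpha>)\<bar>)"

definition Umat :: "nat \<Rightarrow> (nat \<Rightarrow> real \<Rightarrow> complex^'m) \<Rightarrow> real \<Rightarrow> real \<Rightarrow> complex^'m^'m" where
  "Umat N \<phi> x y = (\<chi> j k. \<Sum>n\<in>{1..N}. \<phi> n x $ j * cnj (\<phi> n y $ k))"

end

theory Submission
  imports Defs
begin

text \<open>
  Writing \<open>h(x) = exp (i \<integral>\<^sub>0\<^sup>x a)\<close> and \<open>v = h u\<close> turns \<open>|(i \<partial> - a) u|\<close> into \<open>|v'|\<close> for a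
  function with \<open>v(2\<pi>) = exp (2\<pi>i\<alpha>) v(0)\<close>. Comparing \<open>\<integral> |v'|\<^sup>2 + c\<^sup>2 |v|\<^sup>2\<close> with its minimiser under a
  prescribed value at \<open>x\<close>, a multiple of the Green function, and optimising over \<open>c\<close> gives the
  interpolation inequality \<open>|u(x)|\<^sup>4 \<le> K(\<alpha>)\<^sup>2 \<parallel>u\<parallel>\<^sup>2 \<parallel>(i \<partial> - a) u\<parallel>\<^sup>2\<close>.
  Following Eden and Foias, it is applied, for each eigenvector \<open>e\<close> of \<open>U(x,x)\<close>, to the function
  \<open>y \<mapsto> e\<^sup>* U(y,x) e\<close>, whose value at \<open>x\<close> is the eigenvalue \<open>q\<close>. Orthonormality bounds its \<open>L\<^sub>2\<close> norm by
  \<open>\<surd>q\<close>, so \<open>q\<^sup>3\<close> is at most \<open>K(\<alpha>)\<^sup>2\<close> times a quadratic form in \<open>e\<close>. Summing over an eigenbasis gives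
  the trace of that form, and integrating in \<open>x\<close> leaves, again by orthonormality, the kinetic energy.
\<close>

subsection \<open>The magnetic interpolation inequality\<close>

text \<open>\<open>X\<close> is an absolutely continuous curve whose derivative \<open>\<xi>\<close>
  is only in L1. On a short interval around \<open>x\<close>, both the increment of
  \<open>\<Phi>\<close> along \<open>X\<close> and the integral agree with \<open>G (X x)\<close>
  applied to the increment of \<open>X\<close>, up to a small multiple of the integral of
  \<open>norm (\<xi> t)\<close>.\<close>

lemma absolutely_continuous_chain_rule:
  fixes X \<xi> :: "real \<Rightarrow> 'a::euclidean_space" and \<Phi> :: "'a \<Rightarrow> real"
  assumes "a \<le> b"
    and \<xi>: "\<xi> absolutely_integrable_on {a..b}"
    and X: "\<And>t. t \<in> {a..b} \<Longrightarrow> X t = X a + integral {a..t} \<xi>"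
    and der: "\<And>z. (\<Phi> has_derivative (\<lambda>h. G z \<bullet> h)) (at z)"
    and G: "continuous_on UNIV G"
  shows "(\<lambda>t. G (X t) \<bullet> \<xi> t) absolutely_integrable_on {a..b}"
    and "integral {a..b} (\<lambda>t. G (X t) \<bullet> \<xi> t) = \<Phi> (X b) - \<Phi> (X a)"
proof -
  have int: "\<xi> integrable_on {a..b}" and nint: "(\<lambda>t. norm (\<xi> t)) integrable_on {a..b}"
    using \<xi> unfolding absolutely_integrable_on_def by auto
  have "continuous_on {a..b} (\<lambda>t. X a + integral {a..t} \<xi>)"
    by (intro continuous_intros indefinite_integral_continuous_1 int)
  then have contX: "continuous_on {a..b} X"
    by (rule continuous_on_eq) (simp add: X[symmetric])
  have contGX: "continuous_on {a..b} (\<lambda>t. G (X t))"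
    by (rule continuous_on_compose2[OF G contX]) auto
  have "bounded ((\<lambda>t. G (X t)) ` {a..b})"
    by (intro compact_imp_bounded compact_continuous_image contGX) auto
  then show ai: "(\<lambda>t. G (X t) \<bullet> \<xi> t) absolutely_integrable_on {a..b}"
    by (intro absolutely_integrable_bounded_measurable_product[where h="(\<bullet>)", OF _ _ _ _ \<xi>]
        bilinear_conv_bounded_bilinear[THEN iffD2] bounded_bilinear_inner
        continuous_imp_measurable_on_sets_lebesgue contGX) auto
  let ?f = "\<lambda>t. G (X t) \<bullet> \<xi> t"
  have fint: "?f integrable_on {a..b}"
    using ai set_lebesgue_integral_eq_integral(1) by blast
  have sub: "?f integrable_on {s..t}" "\<xi> integrable_on {s..t}" "(\<lambda>t. norm (\<xi> t)) integrable_on {s..t}"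
    if "a \<le> s" "t \<le> b" for s t
  proof -
    have "{s..t} \<subseteq> {a..b}" using that by auto
    then show "?f integrable_on {s..t}" "\<xi> integrable_on {s..t}" "(\<lambda>t. norm (\<xi> t)) integrable_on {s..t}"
      using integrable_on_subinterval fint int nint by blast+
  qed
  have sub': "(\<lambda>r. c \<bullet> \<xi> r) integrable_on {s..t}" if "a \<le> s" "t \<le> b" for s t c
    using integrable_linear[OF sub(2)[OF that] bounded_linear_inner_right[of c]] by (simp add: o_def)
  have comb: "integral {s..u} ?f = integral {s..t} ?f + integral {t..u} ?f"
    "integral {s..u} \<xi> = integral {s..t} \<xi> + integral {t..u} \<xi>"
    "integral {s..u} (\<lambda>t. norm (\<xi> t)) = integral {s..t} (\<lambda>t. norm (\<xi> t)) + integral {t..u} (\<lambda>t. norm (\<xi> t))"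
    if "a \<le> s" "s \<le> t" "t \<le> u" "u \<le> b" for s t u
    using Henstock_Kurzweil_Integration.integral_combine[OF that(2,3)] sub[OF that(1,4)] by metis+
  have Xdiff: "X t - X s = integral {s..t} \<xi>" if "a \<le> s" "s \<le> t" "t \<le> b" for s t
    using that X[of s] X[of t] comb(2)[of a s t] by simp
  \<comment> \<open>The error is additive in the interval, so it suffices to bound it on short intervals; this needs
    neither differentiability of \<open>X\<close> almost everywhere nor density of continuous functions in \<open>L\<^sub>1\<close>.\<close>
  have key: "\<bar>\<Phi> (X b) - \<Phi> (X a) - integral {a..b} ?f\<bar> \<le> e * integral {a..b} (\<lambda>t. norm (\<xi> t))"
    if "e > 0" for e
  proof -
    define P where "P s t \<longleftrightarrow> a \<le> s \<and> t \<le> b \<longrightarrow>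
      \<bar>\<Phi> (X t) - \<Phi> (X s) - integral {s..t} ?f\<bar> \<le> e * integral {s..t} (\<lambda>t. norm (\<xi> t))" for s t
    have "P a b"
      \<comment> \<open>Bisection reduces the estimate to its additivity and its validity near each
        point.\<close>
      using \<open>a \<le> b\<close>
    proof (induction rule: Bolzano)
      case (trans s t u)
      show ?case unfolding P_def
      proof (intro impI)
        assume su: "a \<le> s \<and> u \<le> b"
        have "integral {s..u} ?f = integral {s..t} ?f + integral {t..u} ?f"
          "integral {s..u} (\<lambda>t. norm (\<xi> t)) = integral {s..t} (\<lambda>t. norm (\<xi> t)) + integral {t..u} (\<lambda>t. norm (\<xi> t))"
          using comb[OF _ trans(3,4)] su by auto
        moreover have "\<bar>\<Phi> (X t) - \<Phi> (X s) - integral {s..t} ?f\<bar> \<le> e * integral {s..t} (\<lambda>t. norm (\<xi> t))"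
          "\<bar>\<Phi> (X u) - \<Phi> (X t) - integral {t..u} ?f\<bar> \<le> e * integral {t..u} (\<lambda>t. norm (\<xi> t))"
          using trans su unfolding P_def by auto
        ultimately show "\<bar>\<Phi> (X u) - \<Phi> (X s) - integral {s..u} ?f\<bar> \<le> e * integral {s..u} (\<lambda>t. norm (\<xi> t))"
          by (simp add: distrib_left)
      qed
    next
      case (local x)
      then have x: "x \<in> {a..b}" by simp
      let ?e = "e/2"
      have e2: "?e > 0" using \<open>e > 0\<close> by simp
      obtain d1 where d1: "d1 > 0" "\<And>z. norm (z - X x) < d1 \<Longrightarrow>
          norm (\<Phi> z - \<Phi> (X x) - G (X x) \<bullet> (z - X x)) \<le> ?e * norm (z - X x)"
        using der[of "X x"] e2 unfolding has_derivative_at_alt by blast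
      obtain d2 where d2: "d2 > 0" "\<And>z. z \<in> {a..b} \<Longrightarrow> dist z x < d2 \<Longrightarrow> dist (G (X z)) (G (X x)) < ?e"
        using contGX[unfolded continuous_on_iff, rule_format, OF x e2] by blast
      obtain d3 where d3: "d3 > 0" "\<And>z. z \<in> {a..b} \<Longrightarrow> dist z x < d3 \<Longrightarrow> dist (X z) (X x) < d1"
        using contX[unfolded continuous_on_iff, rule_format, OF x d1(1)] by blast
      have "P s t" if st: "s \<le> x" "x \<le> t" "t - s < min d2 d3" for s t
        unfolding P_def
      proof (intro impI)
        assume ab: "a \<le> s \<and> t \<le> b"
        let ?n = "\<lambda>u v. integral {u..v} (\<lambda>t. norm (\<xi> t))"
        have near: "dist r x < min d2 d3" if "r \<in> {s..t}" for r
          using that st by (auto simp: dist_real_def)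
        have n: "?n s t = ?n s x + ?n x t"
          using comb(3)[OF _ st(1,2)] ab by auto
        have X1: "norm (X t - X x) \<le> ?n x t" "norm (X x - X s) \<le> ?n s x"
          using st ab local by (auto simp: Xdiff intro!: integral_norm_bound_integral sub)
        have A: "\<bar>\<Phi> (X t) - \<Phi> (X x) - G (X x) \<bullet> (X t - X x)\<bar> \<le> ?e * ?n x t"
        proof -
          have "norm (X t - X x) < d1"
            using d3(2)[of t] near[of t] st ab local by (auto simp: dist_norm)
          from d1(2)[OF this] show ?thesis
            using X1(1) e2 by (smt (verit) mult_left_mono real_norm_def)
        qed
        have B: "\<bar>\<Phi> (X s) - \<Phi> (X x) - G (X x) \<bullet> (X s - X x)\<bar> \<le> ?e * ?n s x"
        proof -
          have "norm (X s - X x) < d1"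
            using d3(2)[of s] near[of s] st ab local by (auto simp: dist_norm)
          from d1(2)[OF this] show ?thesis
            using X1(2) e2 by (smt (verit) mult_left_mono real_norm_def norm_minus_commute)
        qed
        have C: "\<bar>integral {s..t} ?f - G (X x) \<bullet> (X t - X s)\<bar> \<le> ?e * ?n s t"
        proof -
          have "G (X x) \<bullet> (X t - X s) = integral {s..t} (\<lambda>r. G (X x) \<bullet> \<xi> r)"
            using st ab by (subst Xdiff) (use integral_linear[OF sub(2)[of s t] bounded_linear_inner_right[of "G (X x)"]] in \<open>auto simp: o_def\<close>)
          then have "integral {s..t} ?f - G (X x) \<bullet> (X t - X s) = integral {s..t} (\<lambda>r. ?f r - G (X x) \<bullet> \<xi> r)"
            using ab by (simp add: Henstock_Kurzweil_Integration.integral_diff sub sub')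
          also have "norm \<dots> \<le> integral {s..t} (\<lambda>r. ?e * norm (\<xi> r))"
          proof (rule integral_norm_bound_integral)
            show "(\<lambda>r. ?f r - G (X x) \<bullet> \<xi> r) integrable_on {s..t}"
              using ab by (intro integrable_diff sub sub') auto
            show "(\<lambda>r. ?e * norm (\<xi> r)) integrable_on {s..t}"
              using ab by (intro integrable_on_mult_right sub) auto
            show "norm (?f r - G (X x) \<bullet> \<xi> r) \<le> ?e * norm (\<xi> r)" if "r \<in> {s..t}" for r
            proof -
              have "norm (?f r - G (X x) \<bullet> \<xi> r) \<le> norm (G (X r) - G (X x)) * norm (\<xi> r)"
                by (simp add: inner_diff_left[symmetric] Cauchy_Schwarz_ineq2)
              also have "\<dots> \<le> ?e * norm (\<xi> r)"
                using d2(2)[of r] near[OF that] that ab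
                by (intro mult_right_mono) (auto simp: dist_norm)
              finally show ?thesis .
            qed
          qed
          finally show ?thesis by simp
        qed
        \<comment> \<open>The terms linear in \<open>X\<close> cancel in \<open>p - q - r\<close>.
          The two endpoint errors together, and the integral error alone, each cost half of the
          allowance; hence the halved \<open>e\<close> above.\<close>
        have "\<bar>p - q - r\<bar> \<le> 2 * E" if "\<bar>p\<bar> \<le> E1" "\<bar>q\<bar> \<le> E2" "\<bar>r\<bar> \<le> E" "E = E1 + E2" for p q r E E1 E2 :: real
          using that by linarith
        from this[OF A B C] show "\<bar>\<Phi> (X t) - \<Phi> (X s) - integral {s..t} ?f\<bar> \<le> e * ?n s t"
          by (simp add: n algebra_simps)
      qed
      then show ?case
        using d2(1) d3(1) by (intro exI[of _ "min d2 d3"]) auto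
    qed
    then show ?thesis unfolding P_def by simp
  qed
  let ?N = "integral {a..b} (\<lambda>t. norm (\<xi> t))"
  have N: "?N \<ge> 0" by (rule integral_nonneg[OF nint]) auto
  have "\<bar>\<Phi> (X b) - \<Phi> (X a) - integral {a..b} ?f\<bar> \<le> 0"
  proof (rule field_le_epsilon)
    fix e :: real assume "e > 0"
    have "\<bar>\<Phi> (X b) - \<Phi> (X a) - integral {a..b} ?f\<bar> \<le> e / (?N + 1) * ?N"
      using N \<open>e > 0\<close> by (intro key) auto
    also have "\<dots> \<le> e" using N \<open>e > 0\<close> by (simp add: field_simps)
    finally show "\<bar>\<Phi> (X b) - \<Phi> (X a) - integral {a..b} ?f\<bar> \<le> 0 + e" by simp
  qed
  then show "integral {a..b} ?f = \<Phi> (X b) - \<Phi> (X a)" by simp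
qed

section \<open>Lower bounds for the magnetic energy by boundary terms\<close>

lemma complex_inner_Re: "x \<bullet> y = Re (cnj x * y)"
  by (simp add: inner_complex_def)

text \<open>With \<open>v = cis B * u\<close>, expand the nonnegative integral of
  \<open>|v' - g'|^2 + c^2 |v - g|^2\<close>. Since \<open>g'' = c^2 g\<close>, everything apart
  from the energy of \<open>v\<close> is, up to sign, the derivative of
  \<open>2 Re (v * cnj g') - Re (g * cnj g')\<close>, which leaves the boundary terms on the
  left.\<close>

lemma magnetic_energy_lower_bound:
  fixes a B :: "real \<Rightarrow> real" and u w g g1 :: "real \<Rightarrow> complex" and c :: real
  assumes "p \<le> q"
    and a: "a absolutely_integrable_on {p..q}" and w: "w absolutely_integrable_on {p..q}"
    and B: "\<And>t. t \<in> {p..q} \<Longrightarrow> B t = B p + integral {p..t} a"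
    and u: "\<And>t. t \<in> {p..q} \<Longrightarrow> u t = u p + integral {p..t} w"
    and g: "\<And>t. (g has_vector_derivative g1 t) (at t)"
    and g1: "\<And>t. (g1 has_vector_derivative c\<^sup>2 *\<^sub>R g t) (at t)"
    and E: "(\<lambda>t. (cmod (\<i> * w t - a t * u t))\<^sup>2 + c\<^sup>2 * (cmod (u t))\<^sup>2) integrable_on {p..q}"
  shows "(2 * Re (cis (B q) * u q * cnj (g1 q)) - Re (g q * cnj (g1 q)))
       - (2 * Re (cis (B p) * u p * cnj (g1 p)) - Re (g p * cnj (g1 p)))
       \<le> integral {p..q} (\<lambda>t. (cmod (\<i> * w t - a t * u t))\<^sup>2 + c\<^sup>2 * (cmod (u t))\<^sup>2)"
proof -
  \<comment> \<open>Time, phase and value are kept as separate coordinates: the boundary term is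
    then a smooth function along one absolutely continuous curve, and a single chain rule replaces
    product rules. \<open>G\<close> is its gradient; the conjugation in the last component comes
    from \<open>complex_inner_Re\<close>.\<close>
  define \<Phi> :: "real \<times> real \<times> complex \<Rightarrow> real" where
    "\<Phi> = (\<lambda>z. 2 * Re (cis (fst (snd z)) * snd (snd z) * cnj (g1 (fst z))) - Re (g (fst z) * cnj (g1 (fst z))))"
  define G :: "real \<times> real \<times> complex \<Rightarrow> real \<times> real \<times> complex" where
    "G = (\<lambda>(t, b, v).
      (2 * Re (cis b * v * cnj (c\<^sup>2 *\<^sub>R g t)) - (Re (g1 t * cnj (g1 t)) + Re (g t * cnj (c\<^sup>2 *\<^sub>R g t))),
       2 * Re (\<i> * cis b * v * cnj (g1 t)),
       2 * cnj (cis b * cnj (g1 t))))"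
  define X where "X t = (t, B t, u t)" for t
  define \<xi> where "\<xi> t = (1::real, a t, w t)" for t
  have gc: "continuous_on UNIV g" "continuous_on UNIV g1"
    using g g1 by (auto simp: continuous_on_eq_continuous_at intro: has_vector_derivative_continuous)
  have aint: "a integrable_on {p..q}" "w integrable_on {p..q}"
    using a w set_lebesgue_integral_eq_integral(1) by blast+
  have one: "(\<lambda>t::real. 1::real) absolutely_integrable_on {p..q}"
    by (intro absolutely_integrable_continuous_real continuous_intros)
  have \<xi>_eq: "\<xi> = (\<lambda>t. ((\<lambda>r. (r, 0, 0)) \<circ> (\<lambda>t. 1)) t + (((\<lambda>r. (0, r, 0)) \<circ> a) t + ((\<lambda>r. (0, 0, r)) \<circ> w) t))"
    by (auto simp: \<xi>_def)
  have lin: "bounded_linear (\<lambda>r. (r, 0::real, 0::complex))" "bounded_linear (\<lambda>r. (0::real, r, 0::complex))"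
    "bounded_linear (\<lambda>r. (0::real, 0::real, r))"
    by (intro bounded_linear_Pair bounded_linear_ident bounded_linear_zero)+
  have \<xi>: "\<xi> absolutely_integrable_on {p..q}"
    unfolding \<xi>_eq by (intro set_integral_add absolutely_integrable_linear lin one a w)
  have X: "X t = X p + integral {p..t} \<xi>" if "t \<in> {p..q}" for t
  proof -
    have sub: "a integrable_on {p..t}" "w integrable_on {p..t}" "(\<lambda>t::real. 1::real) integrable_on {p..t}"
      using aint that by (auto intro: integrable_on_subinterval)
    have "(\<xi> has_integral (integral {p..t} (\<lambda>t. 1), 0, 0)
        + ((0, integral {p..t} a, 0) + (0, 0, integral {p..t} w))) {p..t}"
      unfolding \<xi>_eq by (intro has_integral_add has_integral_linear[OF integrable_integral] lin sub)
    then have "integral {p..t} \<xi> = (t - p, integral {p..t} a, integral {p..t} w)"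
      using that by (simp add: integral_unique)
    then show ?thesis using B[OF that] u[OF that] by (simp add: X_def)
  qed
  have der: "(\<Phi> has_derivative (\<lambda>h. G z \<bullet> h)) (at z)" for z
  proof -
    obtain t b v where z: "z = (t, b, v)" by (cases z) auto
    have 1: "((\<lambda>z. g (fst z)) has_derivative (\<lambda>h. fst h *\<^sub>R g1 (fst z))) (at z)"
      "((\<lambda>z. g1 (fst z)) has_derivative (\<lambda>h. fst h *\<^sub>R (c\<^sup>2 *\<^sub>R g (fst z)))) (at z)"
      for z :: "real \<times> real \<times> complex"
      by (rule has_derivative_compose[OF has_derivative_fst[OF has_derivative_ident]
            g[unfolded has_vector_derivative_def]],
          rule has_derivative_compose[OF has_derivative_fst[OF has_derivative_ident]
            g1[unfolded has_vector_derivative_def]])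
    show ?thesis unfolding \<Phi>_def
      by (rule derivative_eq_intros 1 refl)+
        (auto simp: fun_eq_iff z G_def complex_inner_Re algebra_simps)
  qed
  have G: "continuous_on UNIV G"
    unfolding G_def case_prod_unfold
    by (intro continuous_intros continuous_on_compose2[OF gc(1)] continuous_on_compose2[OF gc(2)]) auto
  have chain: "(\<lambda>t. G (X t) \<bullet> \<xi> t) absolutely_integrable_on {p..q}"
    "\<Phi> (X q) - \<Phi> (X p) = integral {p..q} (\<lambda>t. G (X t) \<bullet> \<xi> t)"
    using absolutely_continuous_chain_rule[OF \<open>p \<le> q\<close> \<xi> _ der G, of X] X by metis+
  have "\<Phi> (X q) - \<Phi> (X p) \<le> integral {p..q} (\<lambda>t. (cmod (\<i> * w t - a t * u t))\<^sup>2 + c\<^sup>2 * (cmod (u t))\<^sup>2)"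
    unfolding chain(2)
  proof (rule integral_le)
    show "(\<lambda>t. G (X t) \<bullet> \<xi> t) integrable_on {p..q}"
      using chain(1) set_lebesgue_integral_eq_integral(1) by blast
    show "G (X t) \<bullet> \<xi> t \<le> (cmod (\<i> * w t - a t * u t))\<^sup>2 + c\<^sup>2 * (cmod (u t))\<^sup>2" if "t \<in> {p..q}" for t
    proof -
      \<comment> \<open>\<open>W\<close> is the derivative of \<open>V\<close>. The phase absorbs
        the potential, so \<open>cmod W\<close> is the modulus of the magnetic derivative.\<close>
      define V W where "V = cis (B t) * u t" and "W = cis (B t) * (w t + \<i> * a t * u t)"
      have sq: "2 * Re (x * cnj y) \<le> (cmod x)\<^sup>2 + (cmod y)\<^sup>2" for x y
      proof -
        have "0 \<le> (cmod (x - y))\<^sup>2" by simp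
        then show ?thesis unfolding cmod_power2 by (simp add: power2_eq_square algebra_simps)
      qed
      have cW: "cmod W = cmod (\<i> * w t - a t * u t)"
      proof -
        have "W = - \<i> * cis (B t) * (\<i> * w t - a t * u t)" by (simp add: W_def algebra_simps)
        then show ?thesis by (simp add: norm_mult)
      qed
      have cV: "cmod V = cmod (u t)" by (simp add: V_def norm_mult)
      have "G (X t) \<bullet> \<xi> t = 2 * Re (W * cnj (g1 t)) - (cmod (g1 t))\<^sup>2 + c\<^sup>2 * (2 * Re (V * cnj (g t)) - (cmod (g t))\<^sup>2)"
        unfolding cmod_power2
        by (simp add: G_def X_def \<xi>_def V_def W_def complex_inner_Re algebra_simps power2_eq_square)
      also have "\<dots> \<le> (cmod W)\<^sup>2 + c\<^sup>2 * (cmod V)\<^sup>2"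
        using sq[of W "g1 t"] mult_left_mono[OF sq[of V "g t"], of "c\<^sup>2"]
        by (simp add: algebra_simps)
      finally show ?thesis unfolding cW cV .
    qed
  qed (rule E)
  then show ?thesis by (simp add: \<Phi>_def X_def)
qed

section \<open>The Green function with twisted boundary condition\<close>

text \<open>The solution of \<open>g'' = c\<^sup>2 g\<close> on \<open>[y, y + 2\<pi>]\<close> with boundary values \<open>p\<close> and \<open>r\<close>, and its derivative.\<close>

definition green :: "real \<Rightarrow> real \<Rightarrow> complex \<Rightarrow> complex \<Rightarrow> real \<Rightarrow> complex" where
  "green c y p r t = (sinh (c * (y + 2*pi - t)) *\<^sub>R p + sinh (c * (t - y)) *\<^sub>R r) /\<^sub>R sinh (2*pi*c)"

definition green' :: "real \<Rightarrow> real \<Rightarrow> complex \<Rightarrow> complex \<Rightarrow> real \<Rightarrow> complex" where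
  "green' c y p r t = (c / sinh (2*pi*c)) *\<^sub>R (cosh (c * (t - y)) *\<^sub>R r - cosh (c * (y + 2*pi - t)) *\<^sub>R p)"

lemma green_deriv:
  "(green c y p r has_vector_derivative green' c y p r t) (at t)"
  "(green' c y p r has_vector_derivative c\<^sup>2 *\<^sub>R green c y p r t) (at t)"
proof -
  have [derivative_intros]: "((\<lambda>t. sinh (c * (y + 2*pi - t))) has_real_derivative - c * cosh (c * (y + 2*pi - t))) (at t)"
    "((\<lambda>t. cosh (c * (y + 2*pi - t))) has_real_derivative - c * sinh (c * (y + 2*pi - t))) (at t)"
    "((\<lambda>t. sinh (c * (t - y))) has_real_derivative c * cosh (c * (t - y))) (at t)"
    "((\<lambda>t. cosh (c * (t - y))) has_real_derivative c * sinh (c * (t - y))) (at t)"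
    by (auto intro!: derivative_eq_intros)
  note this[THEN has_vector_derivative_scaleR, OF has_vector_derivative_const]
  note intros = has_vector_derivative_add has_vector_derivative_diff
    bounded_linear.has_vector_derivative[OF bounded_linear_scaleR_right] this
  show "(green c y p r has_vector_derivative green' c y p r t) (at t)"
    unfolding green_def[abs_def]
    by (rule has_vector_derivative_eq_rhs, (rule intros)+)
      (simp add: green'_def algebra_simps divide_inverse)
  show "(green' c y p r has_vector_derivative c\<^sup>2 *\<^sub>R green c y p r t) (at t)"
    unfolding green'_def[abs_def]
    by (rule has_vector_derivative_eq_rhs, (rule intros)+)
      (simp add: green_def algebra_simps divide_inverse power2_eq_square)
qed

text \<open>The factor in front of \<open>(cmod (u x))\<^sup>2\<close> is the reciprocal of the
  diagonal value of the Green function of \<open>- d^2/dt^2 + c^2\<close> on the circle with twist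
  \<open>cis\<close> of the total flux. The competitor is the multiple of that Green function taking
  the value \<open>V x\<close> at \<open>x\<close>.\<close>

lemma green_trace_bound:
  fixes a :: "real \<Rightarrow> real" and u w :: "real \<Rightarrow> complex" and c :: real
  assumes a: "a absolutely_integrable_on {0..2*pi}" and w: "w absolutely_integrable_on {0..2*pi}"
    and u: "\<And>t. t \<in> {0..2*pi} \<Longrightarrow> u t = u 0 + integral {0..t} w" and per: "u (2*pi) = u 0"
    and E: "(\<lambda>t. (cmod (\<i> * w t - a t * u t))\<^sup>2 + c\<^sup>2 * (cmod (u t))\<^sup>2) integrable_on {0..2*pi}"
    and x: "x \<in> {0..2*pi}" and "c > 0"
  shows "2 * c * (cosh (2*pi*c) - cos (integral {0..2*pi} a)) / sinh (2*pi*c) * (cmod (u x))\<^sup>2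
     \<le> integral {0..2*pi} (\<lambda>t. (cmod (\<i> * w t - a t * u t))\<^sup>2 + c\<^sup>2 * (cmod (u t))\<^sup>2)"
proof -
  let ?E = "\<lambda>t. (cmod (\<i> * w t - a t * u t))\<^sup>2 + c\<^sup>2 * (cmod (u t))\<^sup>2"
  define B where "B t = integral {0..t} a" for t
  define V where "V t = cis (B t) * u t" for t
  define q where "q = cis (B (2*pi))"
  define p where "p = V x"
  \<comment> \<open>\<open>k\<close> is the quasi-periodic continuation of \<open>h\<close> to the left of \<open>x\<close>, so the boundary terms at \<open>0\<close> and
    \<open>2\<pi>\<close> cancel and only the jump of the derivative at \<open>x\<close> remains.\<close>
  define h where "h = green c x p (q * p)"
  define h' where "h' = green' c x p (q * p)"
  define k where "k = green c (x - 2*pi) (cnj q * p) p"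
  define k' where "k' = green' c (x - 2*pi) (cnj q * p) p"
  have q: "cnj q * q = 1" "q * cnj q = 1" by (simp_all add: q_def cis_cnj cis_mult)
  have aint: "a integrable_on {0..2*pi}" "w integrable_on {0..2*pi}"
    using a w set_lebesgue_integral_eq_integral(1) by blast+
  have sub: "{0..x} \<subseteq> {0..2*pi}" "{x..2*pi} \<subseteq> {0..2*pi}" using x by auto
  have Bx: "B t = B x + integral {x..t} a" and ux: "u t = u x + integral {x..t} w" if "t \<in> {x..2*pi}" for t
  proof -
    have "a integrable_on {0..t}" "w integrable_on {0..t}"
      using that x by (auto intro: integrable_on_subinterval[OF aint(1)] integrable_on_subinterval[OF aint(2)])
    from this[THEN Henstock_Kurzweil_Integration.integral_combine[rotated 2], of x]
    show "B t = B x + integral {x..t} a" "u t = u x + integral {x..t} w"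
      using that x u[of x] u[of t] by (simp_all add: B_def)
  qed
  have B0: "B t = B 0 + integral {0..t} a" for t by (simp add: B_def)
  have ss: "sinh (2*pi*c) \<noteq> 0" using \<open>c > 0\<close> by simp
  have I1: "(2 * Re (V (2*pi) * cnj (h' (2*pi))) - Re (h (2*pi) * cnj (h' (2*pi))))
      - (2 * Re (V x * cnj (h' x)) - Re (h x * cnj (h' x))) \<le> integral {x..2*pi} ?E"
    unfolding V_def h_def h'_def
    by (rule magnetic_energy_lower_bound[OF _ _ _ Bx ux green_deriv])
      (use x E sub in \<open>auto intro: absolutely_integrable_on_subinterval[OF a] absolutely_integrable_on_subinterval[OF w]
        integrable_on_subinterval\<close>)
  have I2: "(2 * Re (V x * cnj (k' x)) - Re (k x * cnj (k' x)))
      - (2 * Re (V 0 * cnj (k' 0)) - Re (k 0 * cnj (k' 0))) \<le> integral {0..x} ?E"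
    unfolding V_def k_def k'_def
    by (rule magnetic_energy_lower_bound[OF _ _ _ B0 u green_deriv])
      (use x E sub in \<open>auto intro: absolutely_integrable_on_subinterval[OF a] absolutely_integrable_on_subinterval[OF w]
        integrable_on_subinterval\<close>)
  have V2: "V (2*pi) = q * V 0" by (simp add: V_def q_def per B_def)
  have h2: "h (2*pi) = q * k 0" "h' (2*pi) = q * k' 0"
    using q by (simp_all add: h_def k_def h'_def k'_def green_def green'_def algebra_simps scaleR_conv_of_real)
  have qq: "q * z * cnj (q * z') = z * cnj z'" for z z'
    using arg_cong[OF q(1), of "\<lambda>r. r * (z * cnj z')"] by (simp add: ac_simps)
  have ends: "Re (V (2*pi) * cnj (h' (2*pi))) = Re (V 0 * cnj (k' 0))"
    "Re (h (2*pi) * cnj (h' (2*pi))) = Re (k 0 * cnj (k' 0))"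
    unfolding V2 h2 qq by (rule refl)+
  have hx: "h x = p" "k x = p"
    using ss by (simp_all add: h_def k_def green_def mult.commute)
  let ?C = "c / sinh (2*pi*c)" and ?m = "cmod p ^ 2"
  have Re_q: "Re (cnj q) = cos (B (2*pi))" by (simp add: q_def)
  have pp: "p * cnj p = of_real ?m" by (simp only: complex_norm_square)
  \<comment> \<open>The two one-sided derivatives at \<open>x\<close>, paired with \<open>p\<close>,
    have opposite real parts, so the jump contributes twice the same amount.\<close>
  have "p * cnj (h' x) = of_real (?C * ?m) * (cnj q - cosh (2*pi*c))"
    unfolding h'_def green'_def of_real_mult pp[symmetric] by (simp add: scaleR_conv_of_real algebra_simps diff_divide_distrib)
  then have hx': "Re (p * cnj (h' x)) = ?C * ?m * (cos (B (2*pi)) - cosh (2*pi*c))"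
    using Re_q by simp
  have "p * cnj (k' x) = of_real (?C * ?m) * (cosh (2*pi*c) - q)"
    unfolding k'_def green'_def of_real_mult pp[symmetric] by (simp add: scaleR_conv_of_real algebra_simps diff_divide_distrib)
  then have kx': "Re (p * cnj (k' x)) = ?C * ?m * (cosh (2*pi*c) - cos (B (2*pi)))"
    using Re_q by simp
  have "2 * c * (cosh (2*pi*c) - cos (B (2*pi))) / sinh (2*pi*c) * ?m \<le> integral {0..x} ?E + integral {x..2*pi} ?E"
  proof -
    define X where "X = ?C * ?m * (cosh (2*pi*c) - cos (B (2*pi)))"
    have "Re (p * cnj (h' x)) = - X" "Re (p * cnj (k' x)) = X"
      unfolding X_def hx' kx' by (simp_all add: right_diff_distrib)
    then have "2 * X \<le> integral {0..x} ?E + integral {x..2*pi} ?E"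
      using I1 I2 unfolding ends hx p_def[symmetric] by linarith
    moreover have "2 * c * (cosh (2*pi*c) - cos (B (2*pi))) / sinh (2*pi*c) * ?m = 2 * X"
      by (simp add: X_def)
    ultimately show ?thesis by simp
  qed
  also have "\<dots> = integral {0..2*pi} ?E"
    using x E by (intro Henstock_Kurzweil_Integration.integral_combine) auto
  also have "cmod p = cmod (u x)" by (simp add: p_def V_def norm_mult)
  finally show ?thesis unfolding B_def .
qed

section \<open>The constant \<open>Kconst\<close> and the optimisation over \<open>c\<close>\<close>

lemma sin_2pi_nonzero:
  assumes "\<alpha> \<notin> \<int>" "frac \<alpha> \<noteq> 1/2"
  shows "sin (2 * pi * \<alpha>) \<noteq> 0"
proof
  assume "sin (2 * pi * \<alpha>) = 0"
  then obtain i where "2 * pi * \<alpha> = of_int i * pi" unfolding sin_zero_iff_int2 by blast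
  then have i: "2 * \<alpha> = of_int i" by simp
  show False
  proof (cases "even i")
    case True
    then obtain k where "i = 2 * k" by blast
    then have "\<alpha> = of_int k" using i by simp
    with assms(1) show False by auto
  next
    case False
    then obtain k where "i = 2 * k + 1" by (elim oddE)
    then have a: "\<alpha> = of_int k + 1/2" using i by simp
    have "\<lfloor>\<alpha>\<rfloor> = k" unfolding a by linarith
    then have "frac \<alpha> = 1/2" unfolding frac_def a by simp
    with assms(2) show False by simp
  qed
qed

text \<open>The sine vanishes only at multiples of 1/2. Integers are excluded, and half-integers
  fall into the range where the constant is 1.\<close>

lemma Kconst_pos:
  assumes "\<alpha> \<notin> \<int>" shows "Kconst \<alpha> > 0"
  using sin_2pi_nonzero[OF assms] by (auto simp: Kconst_def)

text \<open>\<open>Kconst \<alpha>\<close> is the supremum over \<open>s\<close> of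
  \<open>sinh s / (cosh s - cos (2 * pi * \<alpha>))\<close>: for a nonpositive cosine it is the
  limit 1 as \<open>s\<close> grows, for a positive one it is attained where
  \<open>cosh s * cos (2 * pi * \<alpha>) = 1\<close>.\<close>

lemma sinh_le_Kconst:
  fixes s :: real
  assumes "\<alpha> \<notin> \<int>" and "s > 0"
  shows "sinh s \<le> Kconst \<alpha> * (cosh s - cos (2 * pi * \<alpha>))"
proof (cases "1/4 \<le> frac \<alpha> \<and> frac \<alpha> \<le> 3/4")
  case True
  have "2 * pi * \<alpha> = 2 * pi * frac \<alpha> + 2 * pi * of_int \<lfloor>\<alpha>\<rfloor>"
    by (simp add: frac_def algebra_simps)
  then have "cos (2 * pi * \<alpha>) = cos (2 * pi * frac \<alpha>)"
    by (simp add: cos_add)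
  \<comment> \<open>The shift by \<open>pi\<close> moves the angle into the interval from
    \<open>- pi/2\<close> to \<open>pi/2\<close>.\<close>
  also have "\<dots> = - cos (2 * pi * frac \<alpha> - pi)" by simp
  also have "\<dots> \<le> 0"
  proof -
    have "2 * pi * (1/4) \<le> 2 * pi * frac \<alpha>" "2 * pi * frac \<alpha> \<le> 2 * pi * (3/4)"
      using True by (intro mult_left_mono; simp)+
    then have "0 \<le> cos (2 * pi * frac \<alpha> - pi)"
      by (intro cos_ge_zero) linarith+
    then show ?thesis by linarith
  qed
  finally have "cos (2 * pi * \<alpha>) \<le> 0" .
  moreover have "sinh s < cosh s" by (rule sinh_less_cosh_real)
  ultimately show ?thesis using True by (simp add: Kconst_def)
next
  case False
  let ?s = "\<bar>sin (2 * pi * \<alpha>)\<bar>" and ?c = "cos (2 * pi * \<alpha>)"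
  have pos: "?s > 0" using sin_2pi_nonzero[OF assms(1)] False by auto
  \<comment> \<open>The difference of the squares is itself a square, which also shows when equality
    holds.\<close>
  have "(cosh s - ?c)\<^sup>2 - (sinh s * ?s)\<^sup>2 = (1 - cosh s * ?c)\<^sup>2"
    by (simp add: power_mult_distrib sinh_square_eq sin_squared_eq) (simp add: power2_eq_square algebra_simps)
  then have "(sinh s * ?s)\<^sup>2 \<le> (cosh s - ?c)\<^sup>2"
    by (smt (verit) zero_le_power2)
  moreover have "cosh s - ?c \<ge> 0"
    using cosh_real_ge_1[of s] cos_le_one[of "2 * pi * \<alpha>"] by linarith
  ultimately have "sinh s * ?s \<le> cosh s - ?c"
    using power2_le_imp_le by blast
  then have "sinh s \<le> (cosh s - ?c) / ?s" using pos by (simp only: pos_le_divide_eq)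
  moreover have "Kconst \<alpha> = 1 / ?s" using False by (simp only: Kconst_def if_False)
  ultimately show ?thesis by simp
qed

lemma optimize_scale:
  fixes m K E L :: real
  assumes "m \<ge> 0" "K > 0" "L \<ge> 0" and E: "E \<ge> 0"
    and bound: "\<And>c. c > 0 \<Longrightarrow> 2 * c * m \<le> K * (E + c\<^sup>2 * L)"
  shows "m\<^sup>2 \<le> K\<^sup>2 * L * E"
proof (cases "m = 0 \<or> L = 0")
  case False
  then have pos: "m > 0" "L > 0" using assms by auto
  \<comment> \<open>This \<open>c\<close> minimises
    \<open>K * c\<^sup>2 * L - 2 * c * m\<close>.\<close>
  have "2 * (m / (K * L)) * m \<le> K * (E + (m / (K * L))\<^sup>2 * L)"
    using pos assms by (intro bound) auto
  then show ?thesis using pos assms by (simp add: field_simps power2_eq_square)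
next
  case True
  have "m = 0"
  proof (rule ccontr)
    assume "m \<noteq> 0"
    with True assms have L: "L = 0" "m > 0" by auto
    \<comment> \<open>For \<open>L = 0\<close> the right side of the bound does not depend on
      \<open>c\<close>, and this \<open>c\<close> is large enough to violate it.\<close>
    have "K * E / m + 1 > 0"
      using L assms(2) E by (intro add_nonneg_pos divide_nonneg_pos mult_nonneg_nonneg) auto
    then have "2 * (K * E / m + 1) * m \<le> K * E"
      using bound[of "K * E / m + 1"] L by simp
    moreover have "2 * (K * E / m + 1) * m = 2 * (K * E) + 2 * m" using L by (simp add: field_simps)
    moreover have "K * E \<ge> 0" using E assms(2) by simp
    ultimately show False using L by linarith
  qed
  then show ?thesis using E assms by simp
qed

text \<open>\<open>green_trace_bound\<close> holds for every \<open>c > 0\<close>. Its hyperbolic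
  factor is controlled by \<open>sinh_le_Kconst\<close> at \<open>s = 2*pi*c\<close>, uniformly in
  \<open>c\<close>, and the best \<open>c\<close> turns the sum of energy and mass into their
  product.\<close>

lemma magnetic_interpolation:
  fixes a :: "real \<Rightarrow> real" and u w :: "real \<Rightarrow> complex"
  assumes a: "a absolutely_integrable_on {0..2*pi}" and w: "w absolutely_integrable_on {0..2*pi}"
    and flux: "integral {0..2*pi} a / (2*pi) \<notin> \<int>"
    and u: "\<And>t. t \<in> {0..2*pi} \<Longrightarrow> u t = u 0 + integral {0..t} w" and per: "u (2*pi) = u 0"
    and E: "(\<lambda>t. (cmod (\<i> * w t - a t * u t))\<^sup>2) integrable_on {0..2*pi}"
    and x: "x \<in> {0..2*pi}"
  shows "cmod (u x) ^ 4 \<le> (Kconst (integral {0..2*pi} a / (2*pi)))\<^sup>2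
    * integral {0..2*pi} (\<lambda>t. (cmod (u t))\<^sup>2)
    * integral {0..2*pi} (\<lambda>t. (cmod (\<i> * w t - a t * u t))\<^sup>2)"
proof -
  let ?\<alpha> = "integral {0..2*pi} a / (2*pi)"
  let ?E = "integral {0..2*pi} (\<lambda>t. (cmod (\<i> * w t - a t * u t))\<^sup>2)"
  let ?L = "integral {0..2*pi} (\<lambda>t. (cmod (u t))\<^sup>2)"
  have wint: "w integrable_on {0..2*pi}" using w set_lebesgue_integral_eq_integral(1) by blast
  have "continuous_on {0..2*pi} (\<lambda>t. u 0 + integral {0..t} w)"
    by (intro continuous_intros indefinite_integral_continuous_1 wint)
  then have "continuous_on {0..2*pi} u"
    by (rule continuous_on_eq) (simp add: u[symmetric])
  then have Lint: "(\<lambda>t. (cmod (u t))\<^sup>2) integrable_on {0..2*pi}"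
    by (intro integrable_continuous_real continuous_intros)
  have K: "Kconst ?\<alpha> > 0" by (rule Kconst_pos[OF flux])
  have "((cmod (u x))\<^sup>2)\<^sup>2 \<le> (Kconst ?\<alpha>)\<^sup>2 * ?L * ?E"
  proof (rule optimize_scale[OF _ K])
    show "?L \<ge> 0" "?E \<ge> 0" by (intro integral_nonneg Lint E; simp)+
    fix c :: real assume c: "c > 0"
    have cL: "(\<lambda>t. c\<^sup>2 * (cmod (u t))\<^sup>2) integrable_on {0..2*pi}"
      by (intro integrable_on_mult_right Lint)
    have eq: "integral {0..2*pi} (\<lambda>t. (cmod (\<i> * w t - a t * u t))\<^sup>2 + c\<^sup>2 * (cmod (u t))\<^sup>2) = ?E + c\<^sup>2 * ?L"
      by (simp add: Henstock_Kurzweil_Integration.integral_add[OF E cL])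
    have ss: "sinh (2*pi*c) > 0" using c by simp
    have cosa: "cos (2 * pi * ?\<alpha>) = cos (integral {0..2*pi} a)" by simp
    have "sinh (2*pi*c) \<le> Kconst ?\<alpha> * (cosh (2*pi*c) - cos (integral {0..2*pi} a))"
      using sinh_le_Kconst[OF flux, of "2*pi*c"] c unfolding cosa by simp
    then have "1 \<le> Kconst ?\<alpha> * ((cosh (2*pi*c) - cos (integral {0..2*pi} a)) / sinh (2*pi*c))"
      using ss by (simp add: field_simps)
    from mult_right_mono[OF this, of "2 * c * (cmod (u x))\<^sup>2"]
    have "2 * c * (cmod (u x))\<^sup>2 \<le> Kconst ?\<alpha> *
      (2 * c * (cosh (2*pi*c) - cos (integral {0..2*pi} a)) / sinh (2*pi*c) * (cmod (u x))\<^sup>2)"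
      using c by (simp only: times_divide_eq_left times_divide_eq_right mult_ac) simp
    also have "\<dots> \<le> Kconst ?\<alpha> * (?E + c\<^sup>2 * ?L)"
      unfolding eq[symmetric] using K
      by (intro mult_left_mono green_trace_bound[OF a w u per _ x c] integrable_add E cL) auto
    finally show "2 * c * (cmod (u x))\<^sup>2 \<le> Kconst ?\<alpha> * (?E + c\<^sup>2 * ?L)" .
  qed simp
  then show ?thesis by simp
qed

subsection \<open>Eigenbases of self-adjoint maps\<close>

text \<open>A maximiser \<open>v\<close> of the Rayleigh quotient on the unit sphere of
  \<open>S\<close> works. With \<open>l\<close> the maximum, the form \<open>\<beta>\<close> of
  \<open>l - f\<close> is nonnegative on \<open>S\<close> and vanishes at \<open>v\<close>, so
  \<open>v\<close> lies in its kernel.\<close>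

lemma selfadjoint_eigenvector_exists:
  fixes f :: "'a::euclidean_space \<Rightarrow> 'a"
  assumes f: "linear f" and sym: "\<And>x y. f x \<bullet> y = x \<bullet> f y"
    and S: "subspace S" "S \<noteq> {0}" and inv: "\<And>x. x \<in> S \<Longrightarrow> f x \<in> S"
  obtains v l where "v \<in> S" "norm v = 1" "f v = l *\<^sub>R v"
proof -
  have "compact (sphere 0 1 \<inter> S)"
    using S(1) by (intro compact_Int_closed closed_subspace) auto
  moreover have "sphere 0 1 \<inter> S \<noteq> {}"
  proof -
    obtain x where "x \<in> S" "x \<noteq> 0" using S subspace_0 by blast
    then have "x /\<^sub>R norm x \<in> sphere 0 1 \<inter> S" using S(1) by (auto intro: subspace_scale)
    then show ?thesis by blast
  qed
  moreover have "continuous_on (sphere 0 1 \<inter> S) (\<lambda>x. x \<bullet> f x)"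
    by (intro continuous_intros linear_continuous_on f[unfolded linear_conv_bounded_linear])
  ultimately obtain v where "v \<in> sphere 0 1 \<inter> S" and *: "\<forall>x\<in>sphere 0 1 \<inter> S. x \<bullet> f x \<le> v \<bullet> f v"
    using continuous_attains_sup by blast
  then have v: "v \<in> S" "norm v = 1" by auto
  have max: "x \<bullet> f x \<le> v \<bullet> f v" if "x \<in> S" "norm x = 1" for x
    using * that by simp
  define l where "l = v \<bullet> f v"
  define \<beta> where "\<beta> x y = l * (x \<bullet> y) - x \<bullet> f y" for x y
  have pos: "\<beta> x x \<ge> 0" if "x \<in> S" for x
  proof (cases "x = 0")
    case False
    have "(x /\<^sub>R norm x) \<bullet> f (x /\<^sub>R norm x) \<le> l"
      unfolding l_def using that False S(1) by (intro max) (auto intro: subspace_scale)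
    then have "(x \<bullet> f x) / (x \<bullet> x) \<le> l"
      by (simp add: linear_cmul[OF f] dot_square_norm power2_eq_square field_simps)
    then show ?thesis using False by (simp add: \<beta>_def divide_le_eq)
  qed (simp add: \<beta>_def)
  have zero: "\<beta> v y = 0" if y: "y \<in> S" for y
  proof (rule ccontr)
    assume nz: "\<beta> v y \<noteq> 0"
    \<comment> \<open>Adding 1 keeps the denominator of \<open>t\<close> positive even if
      \<open>\<beta> y y = 0\<close>; moving from \<open>v\<close> by \<open>t *\<^sub>R y\<close>
      then makes the form negative.\<close>
    define s where "s = \<beta> y y + 1"
    have s: "s > 0" "\<beta> y y = s - 1" using pos[OF y] by (auto simp: s_def)
    define t where "t = - \<beta> v y / s"
    have "0 \<le> \<beta> (v + t *\<^sub>R y) (v + t *\<^sub>R y)"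
      using v y S(1) by (intro pos) (auto intro: subspace_add subspace_scale)
    also have "\<dots> = \<beta> v v + 2 * t * \<beta> v y + t\<^sup>2 * \<beta> y y"
      using sym[of v y] by (simp add: \<beta>_def linear_add[OF f] linear_cmul[OF f] inner_add_left
          inner_add_right inner_commute power2_eq_square algebra_simps)
    also have "\<beta> v v = 0" using v by (simp add: \<beta>_def l_def dot_square_norm)
    also have "0 + 2 * t * \<beta> v y + t\<^sup>2 * \<beta> y y = - (\<beta> v y)\<^sup>2 * (s + 1) / s\<^sup>2"
      unfolding s(2) using s(1) by (simp add: t_def field_simps power2_eq_square)
    also have "\<dots> < 0"
      using s(1) nz by (simp add: divide_less_0_iff mult_less_0_iff)
    finally show False by simp
  qed
  \<comment> \<open>Testing against the residual itself makes its squared norm vanish.\<close>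
  have "l *\<^sub>R v - f v \<in> S" using v inv S(1) by (auto intro: subspace_diff subspace_scale)
  from zero[OF this] have "(l *\<^sub>R v - f v) \<bullet> (l *\<^sub>R v - f v) = 0"
    unfolding \<beta>_def sym[symmetric] by (simp add: inner_diff_left)
  then have "f v = l *\<^sub>R v" by simp
  with v that show thesis by blast
qed

text \<open>Take an orthonormal system of eigenvectors of maximal size. Its orthogonal complement
  \<open>S\<close> is invariant under \<open>f\<close>, so a nonzero \<open>S\<close> would contain
  one more eigenvector. Eigenvalues are written as \<open>v \<bullet> f v\<close>, which avoids a
  separate function for them.\<close>

lemma selfadjoint_spectral_decomposition:
  fixes f :: "'a::euclidean_space \<Rightarrow> 'a"
  assumes f: "linear f" and sym: "\<And>x y. f x \<bullet> y = x \<bullet> f y"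
  obtains B where "finite B" "\<And>v. v \<in> B \<Longrightarrow> norm v = 1" "\<And>v. v \<in> B \<Longrightarrow> f v = (v \<bullet> f v) *\<^sub>R v"
    "\<And>x. x = (\<Sum>v\<in>B. (v \<bullet> x) *\<^sub>R v)"
proof -
  define P where "P B \<longleftrightarrow> pairwise orthogonal B \<and> (\<forall>v\<in>B. norm v = 1 \<and> (\<exists>l. f v = l *\<^sub>R v))" for B
  have indep: "independent B" if "P B" for B
    using that unfolding P_def by (intro pairwise_orthogonal_independent) auto
  have "\<exists>B. P B \<and> (\<forall>C. P C \<longrightarrow> card C \<le> card B)"
  proof -
    have "P {}" by (simp add: P_def)
    moreover have "\<forall>C. P C \<longrightarrow> card C < Suc DIM('a)"
      using indep independent_bound by (auto simp: less_Suc_eq_le)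
    ultimately show ?thesis using ex_has_greatest_nat[of P "{}" card "Suc DIM('a)"] by auto
  qed
  then obtain B where B: "P B" and max: "\<And>C. P C \<Longrightarrow> card C \<le> card B" by blast
  have fin: "finite B" using indep[OF B] independent_imp_finite by blast
  define S where "S = {x. \<forall>v\<in>B. v \<bullet> x = 0}"
  have S: "subspace S" unfolding S_def subspace_def by (auto simp: inner_add_right)
  have "S = {0}"
  proof (rule ccontr)
    assume "S \<noteq> {0}"
    moreover have "f x \<in> S" if "x \<in> S" for x
      using that B unfolding S_def P_def
      by (auto simp: sym[symmetric])
    ultimately obtain v l where v: "v \<in> S" "norm v = 1" "f v = l *\<^sub>R v"
      using selfadjoint_eigenvector_exists[OF f sym S] by metis
    have "v \<notin> B" using v unfolding S_def by force
    have "P (insert v B)"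
      using B v unfolding P_def S_def pairwise_insert orthogonal_def
      by (auto simp: inner_commute)
    from max[OF this] show False using \<open>v \<notin> B\<close> fin by simp
  qed
  show thesis
  proof
    show "finite B" by (rule fin)
    show n1: "norm v = 1" if "v \<in> B" for v using B that by (auto simp: P_def)
    show "f v = (v \<bullet> f v) *\<^sub>R v" if "v \<in> B" for v
      using B that by (auto simp: P_def dot_square_norm)
    show "x = (\<Sum>v\<in>B. (v \<bullet> x) *\<^sub>R v)" for x
    proof -
      have "x - (\<Sum>v\<in>B. (v \<bullet> x) *\<^sub>R v) \<in> S"
        unfolding S_def
      proof (intro CollectI ballI)
        fix w assume w: "w \<in> B"
        have "w \<bullet> (\<Sum>v\<in>B. (v \<bullet> x) *\<^sub>R v) = (\<Sum>v\<in>B. if v = w then w \<bullet> x else 0)"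
          unfolding inner_sum_right
        proof (rule sum.cong)
          fix v assume v: "v \<in> B"
          show "w \<bullet> (v \<bullet> x) *\<^sub>R v = (if v = w then w \<bullet> x else 0)"
            using B v w n1[OF w] unfolding P_def pairwise_def orthogonal_def
            by (auto simp: dot_square_norm)
        qed simp
        then show "w \<bullet> (x - (\<Sum>v\<in>B. (v \<bullet> x) *\<^sub>R v)) = 0"
          using w fin by (simp add: inner_diff_right)
      qed
      then show ?thesis unfolding \<open>S = {0}\<close> by simp
    qed
  qed
qed

text \<open>Expand the first slot in \<open>Basis\<close>, exchange the sums and recombine the
  second slot over \<open>B\<close>. It serves for the trace of the cubed matrix and for the form
  that bounds it.\<close>

lemma sum_bilinear_basis_independent:
  fixes b :: "'a::euclidean_space \<Rightarrow> 'a \<Rightarrow> real"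
  assumes b: "\<And>x. linear (b x)" "\<And>y. linear (\<lambda>x. b x y)"
    and B: "\<And>x. x = (\<Sum>v\<in>B. (v \<bullet> x) *\<^sub>R v)"
  shows "(\<Sum>v\<in>B. b v v) = (\<Sum>i\<in>Basis. b i i)"
proof -
  have "(\<Sum>v\<in>B. b v v) = (\<Sum>v\<in>B. b (\<Sum>i\<in>Basis. (v \<bullet> i) *\<^sub>R i) v)"
    by (simp add: euclidean_representation)
  also have "\<dots> = (\<Sum>v\<in>B. \<Sum>i\<in>Basis. (v \<bullet> i) * b i v)"
    by (simp add: linear_sum[OF b(2)] linear_cmul[OF b(2)])
  also have "\<dots> = (\<Sum>i\<in>Basis. \<Sum>v\<in>B. (v \<bullet> i) * b i v)"
    by (rule sum.swap)
  also have "\<dots> = (\<Sum>i\<in>Basis. b i (\<Sum>v\<in>B. (v \<bullet> i) *\<^sub>R v))"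
    by (simp add: linear_sum[OF b(1)] linear_cmul[OF b(1)])
  also have "\<dots> = (\<Sum>i\<in>Basis. b i i)"
    by (simp add: B[symmetric])
  finally show ?thesis .
qed

subsection \<open>The trace inequality\<close>

text \<open>The inner product \<open>\<bullet>\<close> on \<open>complex^'m\<close> is real, namely
  the real part of this one; orthonormality and the coefficients of \<open>Umat\<close> involve the
  complex value.\<close>

definition hinner :: "complex^'m \<Rightarrow> complex^'m \<Rightarrow> complex" where
  "hinner v w = (\<Sum>j\<in>UNIV. v $ j * cnj (w $ j))"

lemma hinner_add: "hinner (u + v) w = hinner u w + hinner v w" "hinner w (u + v) = hinner w u + hinner w v"
  by (simp_all add: hinner_def algebra_simps sum.distrib)

lemma hinner_scaleR: "hinner (r *\<^sub>R v) w = of_real r * hinner v w" "hinner w (r *\<^sub>R v) = of_real r * hinner w v"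
  by (simp_all add: hinner_def sum_distrib_left scaleR_conv_of_real[symmetric] scaleR_sum_right algebra_simps)

lemma hinner_scale: "hinner (c *s v) w = c * hinner v w" "hinner w (c *s v) = cnj c * hinner w v"
  by (simp_all add: hinner_def sum_distrib_left mult_ac)

lemma hinner_sum: "hinner (\<Sum>n\<in>S. f n) w = (\<Sum>n\<in>S. hinner (f n) w)" "hinner w (\<Sum>n\<in>S. f n) = (\<Sum>n\<in>S. hinner w (f n))"
  unfolding hinner_def
  by (simp_all add: sum_distrib_right sum_distrib_left sum.swap[of _ S UNIV])

lemma cnj_hinner: "cnj (hinner v w) = hinner w v"
  by (simp add: hinner_def mult.commute)

lemma hinner_axis: "hinner v (axis k c) = v $ k * cnj c"
  by (simp add: hinner_def axis_def if_distrib cong: if_cong)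

lemma inner_eq_Re_hinner: "v \<bullet> w = Re (hinner v w)"
  by (simp add: inner_vec_def hinner_def inner_complex_def)

lemma norm2_eq_sum: "(norm (v :: complex^'m))\<^sup>2 = (\<Sum>j\<in>UNIV. (cmod (v $ j))\<^sup>2)"
  by (simp add: norm_vec_def L2_set_def sum_nonneg)

lemma hinner_self: "hinner v v = of_real ((norm v)\<^sup>2)"
  unfolding norm2_eq_sum hinner_def of_real_sum complex_norm_square ..

lemma cmod_hinner_le: "cmod (hinner v w) \<le> norm v * norm w"
proof -
  have "cmod (hinner v w) \<le> (\<Sum>j\<in>UNIV. cmod (v $ j) * cmod (w $ j))"
    unfolding hinner_def by (rule sum_norm_le) (simp add: norm_mult)
  also have "\<dots> \<le> norm v * norm w"
    unfolding norm_vec_def using L2_set_mult_ineq[of "\<lambda>j. cmod (v $ j)" "\<lambda>j. cmod (w $ j)" UNIV] by simp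
  finally show ?thesis .
qed

text \<open>Applied to \<open>\<phi>\<close>, whose Gram matrix is the identity, and to the magnetic
  derivatives \<open>A\<close>, whose Gram matrix carries the kinetic energy on its
  diagonal.\<close>

lemma gram_integral:
  fixes F :: "'n \<Rightarrow> 'a \<Rightarrow> complex^'m"
  assumes meas: "\<And>n j. n \<in> S \<Longrightarrow> (\<lambda>t. F n t $ j) \<in> borel_measurable M"
    and L2: "\<And>n. n \<in> S \<Longrightarrow> integrable M (\<lambda>t. (norm (F n t))\<^sup>2)"
  shows "\<And>n m. n \<in> S \<Longrightarrow> m \<in> S \<Longrightarrow> integrable M (\<lambda>t. hinner (F n t) (F m t))"
    and "integrable M (\<lambda>t. (norm (\<Sum>n\<in>S. z n *s F n t))\<^sup>2)"
    and "of_real (\<integral>t. (norm (\<Sum>n\<in>S. z n *s F n t))\<^sup>2 \<partial>M)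
      = (\<Sum>n\<in>S. \<Sum>m\<in>S. z n * cnj (z m) * (\<integral>t. hinner (F n t) (F m t) \<partial>M))"
proof -
  show int: "integrable M (\<lambda>t. hinner (F n t) (F m t))" if nm: "n \<in> S" "m \<in> S" for n m
  proof (rule Bochner_Integration.integrable_bound)
    show "integrable M (\<lambda>t. (norm (F n t))\<^sup>2 + (norm (F m t))\<^sup>2)"
      by (intro Bochner_Integration.integrable_add L2 nm)
    show "(\<lambda>t. hinner (F n t) (F m t)) \<in> borel_measurable M"
      unfolding hinner_def
      by (intro borel_measurable_sum borel_measurable_times meas nm
          borel_measurable_continuous_on[where f=cnj] continuous_on_cnj continuous_on_id)
    show "AE t in M. norm (hinner (F n t) (F m t)) \<le> norm ((norm (F n t))\<^sup>2 + (norm (F m t))\<^sup>2)"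
    proof (rule AE_I2)
      fix t
      have "norm (hinner (F n t) (F m t)) \<le> norm (F n t) * norm (F m t)" by (rule cmod_hinner_le)
      also have "\<dots> \<le> (norm (F n t))\<^sup>2 + (norm (F m t))\<^sup>2"
        using sum_squares_bound[of "norm (F n t)" "norm (F m t)"]
          mult_nonneg_nonneg[OF norm_ge_zero[of "F n t"] norm_ge_zero[of "F m t"]] by linarith
      finally show "norm (hinner (F n t) (F m t)) \<le> norm ((norm (F n t))\<^sup>2 + (norm (F m t))\<^sup>2)" by simp
    qed
  qed
  have eq: "of_real ((norm (\<Sum>n\<in>S. z n *s F n t))\<^sup>2)
      = (\<Sum>n\<in>S. \<Sum>m\<in>S. z n * cnj (z m) * hinner (F n t) (F m t))" for t
    unfolding hinner_self[symmetric]
    by (subst sum.swap) (simp add: hinner_sum hinner_scale mult_ac sum_distrib_left)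
  have sint: "integrable M (\<lambda>t. \<Sum>n\<in>S. \<Sum>m\<in>S. z n * cnj (z m) * hinner (F n t) (F m t))"
    by (intro Bochner_Integration.integrable_sum integrable_mult_right int)
  then have "integrable M (\<lambda>t. Re (of_real ((norm (\<Sum>n\<in>S. z n *s F n t))\<^sup>2)))"
    unfolding eq by (rule integrable_Re)
  then show "integrable M (\<lambda>t. (norm (\<Sum>n\<in>S. z n *s F n t))\<^sup>2)" by simp
  show "of_real (\<integral>t. (norm (\<Sum>n\<in>S. z n *s F n t))\<^sup>2 \<partial>M)
      = (\<Sum>n\<in>S. \<Sum>m\<in>S. z n * cnj (z m) * (\<integral>t. hinner (F n t) (F m t) \<partial>M))"
    unfolding integral_complex_of_real[symmetric] eq
    by (simp add: int)
qed

section \<open>Traces over the real basis and the quadratic form of \<open>Umat\<close>\<close>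

lemma sum_Basis_complex_vec:
  fixes h :: "complex^'m \<Rightarrow> real"
  shows "(\<Sum>b\<in>Basis. h b) = (\<Sum>k\<in>UNIV. h (axis k 1) + h (axis k \<i>))"
proof -
  have "(\<Sum>b\<in>Basis. h b) = (\<Sum>(k, c)\<in>UNIV \<times> {1, \<i>}. h (axis k c))"
  proof -
    have B: "(Basis :: (complex^'m) set) = (\<lambda>(k, c). axis k c) ` (UNIV \<times> {1, \<i>})"
      by (force simp: Basis_vec_def Basis_complex_def)
    have inj: "inj_on (\<lambda>(k, c). axis k c :: complex^'m) (UNIV \<times> {1, \<i>})"
      by (auto simp: inj_on_def axis_eq_axis)
    show ?thesis
      unfolding B sum.reindex[OF inj] by (simp add: case_prod_unfold o_def)
  qed
  also have "\<dots> = (\<Sum>k\<in>UNIV. h (axis k 1) + h (axis k \<i>))"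
    by (simp add: sum.cartesian_product[symmetric])
  finally show ?thesis .
qed

text \<open>Each complex coordinate gives two real directions, \<open>1\<close> and
  \<open>\<i>\<close>, and both contribute the real part of the same diagonal entry.\<close>

lemma sum_Basis_matrix_vector:
  fixes T :: "complex^'m^'m"
  shows "(\<Sum>b\<in>Basis. b \<bullet> (T *v b)) = 2 * Re (trace T)"
proof -
  have "axis k c \<bullet> (T *v axis k c) = Re (cnj c * (T $ k $ k * c))" for k and c :: complex
  proof -
    have "(T *v axis k c) $ k = T $ k $ k * c"
      by (simp add: matrix_vector_mult_def axis_def if_distrib cong: if_cong)
    then show ?thesis
      by (subst inner_commute) (simp add: inner_eq_Re_hinner hinner_axis mult.commute)
  qed
  then show ?thesis
    by (simp add: sum_Basis_complex_vec trace_def sum_distrib_left)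
qed

lemma Umat_mult_vec: "Umat N \<phi> x x *v e = (\<Sum>n\<in>{1..N}. cnj (hinner (\<phi> n x) e) *s \<phi> n x)"
  unfolding cnj_hinner
  by (simp add: vec_eq_iff matrix_vector_mult_def Umat_def hinner_def sum_distrib_left sum_distrib_right
      mult_ac) (intro allI sum.swap)

text \<open>In this form one reads off that the matrix is self-adjoint and that its quadratic form
  is a sum of squares.\<close>

lemma inner_Umat: "v \<bullet> (Umat N \<phi> x x *v e) = Re (\<Sum>n\<in>{1..N}. hinner (\<phi> n x) e * cnj (hinner (\<phi> n x) v))"
  unfolding Umat_mult_vec inner_eq_Re_hinner by (simp add: hinner_sum hinner_scale cnj_hinner)

section \<open>The pointwise bound on the trace of the cube\<close>

text \<open>The integrals in the bound do not depend on \<open>x\<close>; only the factors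
  \<open>hinner (\<phi> m x) (\<phi> n x)\<close> do, and orthonormality evaluates those once
  \<open>x\<close> is integrated. The first claim is what makes the upper bound nonnegative
  there.\<close>

lemma trace_cube_le:
  fixes a :: "real \<Rightarrow> real" and \<phi> \<psi> A :: "nat \<Rightarrow> real \<Rightarrow> complex^'m"
  defines "M \<equiv> restrict_space lborel {0..2*pi}"
  assumes a: "a absolutely_integrable_on {0..2*pi}"
    and flux: "integral {0..2*pi} a / (2*pi) \<notin> \<int>"
    and \<psi>: "\<And>n j. n \<in> {1..N} \<Longrightarrow> (\<lambda>t. \<psi> n t $ j) absolutely_integrable_on {0..2*pi}"
    and AC: "\<And>n j t. n \<in> {1..N} \<Longrightarrow> t \<in> {0..2*pi} \<Longrightarrow>
        ((\<lambda>s. \<psi> n s $ j) has_integral (\<phi> n t $ j - \<phi> n 0 $ j)) {0..t}"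
    and per: "\<And>n. n \<in> {1..N} \<Longrightarrow> \<phi> n (2*pi) = \<phi> n 0"
    and meas: "\<And>n j. n \<in> {1..N} \<Longrightarrow> (\<lambda>t. \<phi> n t $ j) \<in> borel_measurable M"
    and L2: "\<And>n. n \<in> {1..N} \<Longrightarrow> integrable M (\<lambda>t. (norm (\<phi> n t))\<^sup>2)"
    and orth: "\<And>n m. n \<in> {1..N} \<Longrightarrow> m \<in> {1..N} \<Longrightarrow>
        (\<integral>t. hinner (\<phi> n t) (\<phi> m t) \<partial>M) = (if n = m then 1 else 0)"
    and A: "\<And>n t j. A n t $ j = \<i> * \<psi> n t $ j - a t * \<phi> n t $ j"
    and measA: "\<And>n j. n \<in> {1..N} \<Longrightarrow> (\<lambda>t. A n t $ j) \<in> borel_measurable M"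
    and L2A: "\<And>n. n \<in> {1..N} \<Longrightarrow> integrable M (\<lambda>t. (norm (A n t))\<^sup>2)"
    and x: "x \<in> {0..2*pi}"
  shows "0 \<le> Re (trace (Umat N \<phi> x x ** Umat N \<phi> x x ** Umat N \<phi> x x))" (is ?nonneg)
    and "Re (trace (Umat N \<phi> x x ** Umat N \<phi> x x ** Umat N \<phi> x x))
      \<le> (Kconst (integral {0..2*pi} a / (2*pi)))\<^sup>2 *
        Re (\<Sum>n\<in>{1..N}. \<Sum>m\<in>{1..N}. (\<integral>t. hinner (A n t) (A m t) \<partial>M) * hinner (\<phi> m x) (\<phi> n x))" (is ?le)
proof -
  let ?S = "{1..N}" and ?I = "{0..2*pi}"
  let ?K = "Kconst (integral {0..2*pi} a / (2*pi))"
  let ?U = "Umat N \<phi> x x"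
  define G where "G n m = (\<integral>t. hinner (A n t) (A m t) \<partial>M)" for n m
  define c where "c e n = hinner (\<phi> n x) e" for e n
  \<comment> \<open>\<open>b e e\<close> is the integral of the squared norm of
    \<open>\<Sum>n\<in>?S. cnj (c e n) *s A n t\<close>. The two-argument version is bilinear over
    the reals, as needed for taking its trace.\<close>
  define b where "b e f = Re (\<Sum>n\<in>?S. \<Sum>m\<in>?S. cnj (c e n) * c f m * G n m)" for e f
  define q where "q e = e \<bullet> (?U *v e)" for e
  \<comment> \<open>The interpolation inequality uses gauge integrals and the Gram expansions use
    integrals over \<open>M\<close>; this is the bridge.\<close>
  have M_int: "g integrable_on ?I" "integral\<^sup>L M g = integral ?I g"
    if "integrable M g" for g :: "real \<Rightarrow> real"
  proof -
    have "set_integrable lborel ?I g"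
      using that by (simp add: M_def set_integrable_def integrable_restrict_space)
    from set_borel_integral_eq_integral[OF this] show "g integrable_on ?I" "integral\<^sup>L M g = integral ?I g"
      by (simp_all add: M_def set_lebesgue_integral_def integral_restrict_space)
  qed
  have q_eq: "q e = (\<Sum>n\<in>?S. (cmod (c e n))\<^sup>2)" for e
    unfolding q_def inner_Umat c_def complex_norm_square[symmetric] by simp
  have unit: "0 \<le> q e \<and> q e ^ 3 \<le> ?K\<^sup>2 * b e e" if e: "norm e = 1" for e
  proof -
    \<comment> \<open>The \<open>z n\<close> are the coefficients of \<open>U(t,x) e\<close> in the
      system \<open>\<phi>\<close>, so \<open>u t\<close> is the form of \<open>U(t,x)\<close> at
      \<open>e\<close> and \<open>u x = q e\<close>. Here \<open>e\<close> may be any unit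
      vector.\<close>
    define z where "z n = cnj (c e n)" for n
    define u where "u t = hinner (\<Sum>n\<in>?S. z n *s \<phi> n t) e" for t
    define w where "w t = hinner (\<Sum>n\<in>?S. z n *s \<psi> n t) e" for t
    \<comment> \<open>Pairing with the unit vector \<open>e\<close> does not increase norms; this
      passes from the vector functions to the scalar \<open>u\<close>, for the mass and for the
      energy.\<close>
    have le: "(cmod (hinner v e))\<^sup>2 \<le> (norm v)\<^sup>2" for v
      using cmod_hinner_le[of v e] e by (intro power_mono) auto
    have w_sum: "w = (\<lambda>t. \<Sum>n\<in>?S. \<Sum>j\<in>UNIV. (z n * cnj (e $ j)) * \<psi> n t $ j)"
      unfolding w_def hinner_sum hinner_scale unfolding hinner_def by (simp add: sum_distrib_left mult_ac)
    have u_sum: "u t = (\<Sum>n\<in>?S. \<Sum>j\<in>UNIV. (z n * cnj (e $ j)) * \<phi> n t $ j)" for t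
      unfolding u_def hinner_sum hinner_scale unfolding hinner_def by (simp add: sum_distrib_left mult_ac)
    have wai: "w absolutely_integrable_on ?I"
      unfolding w_sum by (intro absolutely_integrable_sum set_integrable_mult_right \<psi>) auto
    have wint: "(w has_integral (u t - u 0)) {0..t}" if "t \<in> ?I" for t
      unfolding w_sum u_sum sum_subtractf[symmetric] right_diff_distrib[symmetric]
      by (intro has_integral_sum has_integral_mult_right AC that) auto
    have uAC: "u t = u 0 + integral {0..t} w" if "t \<in> ?I" for t
      using integral_unique[OF wint[OF that]] by simp
    have uper: "u (2*pi) = u 0" by (simp add: u_def per)
    have Aw: "\<i> * w t - a t * u t = hinner (\<Sum>n\<in>?S. z n *s A n t) e" for t
      unfolding w_sum u_sum hinner_sum hinner_scale unfolding hinner_def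
      by (simp add: sum_distrib_left A algebra_simps sum_subtractf)
    have gA: "integrable M (\<lambda>t. (norm (\<Sum>n\<in>?S. z n *s A n t))\<^sup>2)"
      "of_real (\<integral>t. (norm (\<Sum>n\<in>?S. z n *s A n t))\<^sup>2 \<partial>M)
        = (\<Sum>n\<in>?S. \<Sum>m\<in>?S. z n * cnj (z m) * (\<integral>t. hinner (A n t) (A m t) \<partial>M))"
      by (intro gram_integral measA L2A; assumption)+
    have g\<phi>: "integrable M (\<lambda>t. (norm (\<Sum>n\<in>?S. z n *s \<phi> n t))\<^sup>2)"
      "of_real (\<integral>t. (norm (\<Sum>n\<in>?S. z n *s \<phi> n t))\<^sup>2 \<partial>M)
        = (\<Sum>n\<in>?S. \<Sum>m\<in>?S. z n * cnj (z m) * (\<integral>t. hinner (\<phi> n t) (\<phi> m t) \<partial>M))"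
      by (intro gram_integral meas L2; assumption)+
    have "continuous_on ?I (\<lambda>t. u 0 + integral {0..t} w)"
      by (intro continuous_intros indefinite_integral_continuous_1 set_lebesgue_integral_eq_integral(1)[OF wai])
    then have ucont: "continuous_on ?I u"
      by (rule continuous_on_eq) (simp add: uAC[symmetric])
    have Eint: "integrable M (\<lambda>t. (cmod (\<i> * w t - a t * u t))\<^sup>2)"
    proof (rule Bochner_Integration.integrable_bound[OF gA(1)])
      show "(\<lambda>t. (cmod (\<i> * w t - a t * u t))\<^sup>2) \<in> borel_measurable M"
      proof -
        have [measurable]: "(\<lambda>t. hinner (\<Sum>n\<in>?S. z n *s A n t) e) \<in> borel_measurable M"
          unfolding hinner_sum hinner_scale unfolding hinner_def
          by (intro borel_measurable_sum borel_measurable_times measA borel_measurable_const)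
        show ?thesis unfolding Aw by measurable
      qed
    qed (simp_all add: Aw le)
    have "q e ^ 4 \<le> ?K\<^sup>2 * integral ?I (\<lambda>t. (cmod (u t))\<^sup>2) * integral ?I (\<lambda>t. (cmod (\<i> * w t - a t * u t))\<^sup>2)"
    proof -
      have "u x = of_real (q e)"
        unfolding u_def hinner_sum hinner_scale q_eq of_real_sum complex_norm_square
        by (simp add: z_def c_def mult.commute)
      then have "cmod (u x) ^ 4 = q e ^ 4" by (simp add: power_even_abs)
      then show ?thesis
        using magnetic_interpolation[OF a wai flux uAC uper M_int(1)[OF Eint] x] by simp
    qed
    also have "\<dots> \<le> ?K\<^sup>2 * q e * b e e"
    proof -
      have "integral ?I (\<lambda>t. (cmod (u t))\<^sup>2) \<le> (\<integral>t. (norm (\<Sum>n\<in>?S. z n *s \<phi> n t))\<^sup>2 \<partial>M)"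
        unfolding M_int(2)[OF g\<phi>(1)] u_def
        by (intro integral_le M_int(1) g\<phi>(1) le integrable_continuous_real continuous_intros ucont[unfolded u_def])
      also have "\<dots> = Re (\<Sum>n\<in>?S. \<Sum>m\<in>?S. z n * cnj (z m) * (if n = m then 1 else 0))"
      proof -
        have "(\<Sum>n\<in>?S. \<Sum>m\<in>?S. z n * cnj (z m) * (\<integral>t. hinner (\<phi> n t) (\<phi> m t) \<partial>M))
          = (\<Sum>n\<in>?S. \<Sum>m\<in>?S. z n * cnj (z m) * (if n = m then 1 else 0))"
          by (intro sum.cong refl arg_cong2[where f="(*)"] orth)
        then show ?thesis using arg_cong[OF g\<phi>(2), of Re] by (simp only: Re_complex_of_real)
      qed
      also have "\<dots> = q e"
        unfolding q_eq by (simp add: z_def if_distrib complex_mult_cnj cmod_power2 mult.commute cong: if_cong)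
      finally have 1: "integral ?I (\<lambda>t. (cmod (u t))\<^sup>2) \<le> q e" .
      have "integral ?I (\<lambda>t. (cmod (\<i> * w t - a t * u t))\<^sup>2) \<le> (\<integral>t. (norm (\<Sum>n\<in>?S. z n *s A n t))\<^sup>2 \<partial>M)"
        unfolding M_int(2)[OF Eint, symmetric]
        by (intro integral_mono Eint gA(1)) (simp add: Aw le)
      also have "\<dots> = b e e"
        using arg_cong[OF gA(2), of Re] by (simp only: b_def z_def G_def Re_complex_of_real complex_cnj_cnj)
      finally have 2: "integral ?I (\<lambda>t. (cmod (\<i> * w t - a t * u t))\<^sup>2) \<le> b e e" .
      have "0 \<le> integral ?I (\<lambda>t. (cmod (u t))\<^sup>2)" "0 \<le> integral ?I (\<lambda>t. (cmod (\<i> * w t - a t * u t))\<^sup>2)"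
        by (intro integral_nonneg M_int(1)[OF Eint] integrable_continuous_real continuous_intros ucont; simp)+
      then show ?thesis
        unfolding mult.assoc by (intro mult_left_mono mult_mono 1 2) (use 1 in auto)
    qed
    finally have *: "q e ^ 4 \<le> ?K\<^sup>2 * q e * b e e" .
    \<comment> \<open>This settles the case \<open>q e = 0\<close>, in which a factor
      \<open>q e\<close> cannot be cancelled from the quartic bound.\<close>
    have bpos: "0 \<le> b e e"
    proof -
      have "0 \<le> (\<integral>t. (norm (\<Sum>n\<in>?S. z n *s A n t))\<^sup>2 \<partial>M)" by (rule integral_nonneg_AE) simp
      also have "\<dots> = b e e"
        using arg_cong[OF gA(2), of Re] by (simp only: b_def z_def G_def Re_complex_of_real complex_cnj_cnj)
      finally show ?thesis .
    qed
    have "q e \<ge> 0" unfolding q_eq by (intro sum_nonneg) simp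
    moreover have "q e ^ 3 \<le> ?K\<^sup>2 * b e e"
    proof (cases "q e = 0")
      case False
      with \<open>q e \<ge> 0\<close> have "q e > 0" by simp
      moreover have "q e * q e ^ 3 \<le> q e * (?K\<^sup>2 * b e e)" using * by (simp add: eval_nat_numeral mult_ac)
      ultimately show ?thesis by (rule mult_left_le_imp_le[rotated])
    qed (simp add: bpos)
    ultimately show ?thesis by simp
  qed
  have lin: "linear ((*v) ?U)" by (rule matrix_vector_mul_linear)
  have sym: "(?U *v v) \<bullet> v' = v \<bullet> (?U *v v')" for v v'
    unfolding inner_commute[of "?U *v v"] inner_Umat by (simp add: mult.commute)
  \<comment> \<open>An eigenbasis over the reals, which doubles all traces.\<close>
  obtain B where B: "finite B" "\<And>v. v \<in> B \<Longrightarrow> norm v = 1" "\<And>v. v \<in> B \<Longrightarrow> ?U *v v = (v \<bullet> (?U *v v)) *\<^sub>R v"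
    "\<And>v. v = (\<Sum>e\<in>B. (e \<bullet> v) *\<^sub>R e)"
    using selfadjoint_spectral_decomposition[OF lin sym] by blast
  have "2 * Re (trace (?U ** ?U ** ?U)) = (\<Sum>e\<in>B. e \<bullet> ((?U ** ?U ** ?U) *v e))"
    unfolding sum_Basis_matrix_vector[symmetric]
    by (rule sum_bilinear_basis_independent[symmetric, OF _ _ B(4)])
      (auto intro!: linearI simp: inner_add_left inner_add_right linear_add[OF matrix_vector_mul_linear]
        linear_cmul[OF matrix_vector_mul_linear])
  also have "\<dots> = (\<Sum>e\<in>B. q e ^ 3)"
  proof (rule sum.cong)
    fix e assume e: "e \<in> B"
    have Ue: "?U *v e = q e *\<^sub>R e" using B(3)[OF e] unfolding q_def .
    have "(?U ** ?U ** ?U) *v e = (q e ^ 3) *\<^sub>R e"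
      by (simp add: matrix_vector_mul_assoc[symmetric] Ue linear_cmul[OF lin] power3_eq_cube)
    then show "e \<bullet> ((?U ** ?U ** ?U) *v e) = q e ^ 3"
      using B(2)[OF e] by (simp add: dot_square_norm)
  qed simp
  finally have tr: "2 * Re (trace (?U ** ?U ** ?U)) = (\<Sum>e\<in>B. q e ^ 3)" .
  then show ?nonneg using unit B(2) by (smt (verit) sum_nonneg zero_le_power)
  have "(\<Sum>e\<in>B. q e ^ 3) \<le> ?K\<^sup>2 * (\<Sum>e\<in>B. b e e)"
    unfolding sum_distrib_left using unit B(2) by (intro sum_mono) auto
  also have "(\<Sum>e\<in>B. b e e) = (\<Sum>e\<in>Basis. b e e)"
  proof (rule sum_bilinear_basis_independent[of b, OF _ _ B(4)])
    have b_eq: "b e f = (\<Sum>n\<in>?S. \<Sum>m\<in>?S. Re (cnj (c e n) * c f m * G n m))" for e f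
      by (simp only: b_def Re_sum)
    show "linear (b e)" for e
      unfolding b_eq
      by (intro linear_compose_sum ballI linearI; simp add: c_def hinner_add hinner_scaleR algebra_simps)
    show "linear (\<lambda>e. b e f)" for f
      unfolding b_eq
      by (intro linear_compose_sum ballI linearI; simp add: c_def hinner_add hinner_scaleR algebra_simps)
  qed
  also have "\<dots> = 2 * Re (\<Sum>n\<in>?S. \<Sum>m\<in>?S. G n m * hinner (\<phi> m x) (\<phi> n x))"
  proof -
    \<comment> \<open>The factors \<open>1\<close> and \<open>\<i>\<close> have modulus 1 and drop
      out of \<open>b\<close>, so both directions give the same value; the resulting 2 cancels the
      one in \<open>tr\<close>.\<close>
    have "b (axis k 1) (axis k 1) + b (axis k \<i>) (axis k \<i>)
      = 2 * Re (\<Sum>n\<in>?S. \<Sum>m\<in>?S. G n m * (\<phi> m x $ k * cnj (\<phi> n x $ k)))" for k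
      by (simp add: b_def c_def hinner_axis mult_ac)
    then have "(\<Sum>e\<in>Basis. b e e) = 2 * Re (\<Sum>k\<in>UNIV. \<Sum>n\<in>?S. \<Sum>m\<in>?S. G n m * (\<phi> m x $ k * cnj (\<phi> n x $ k)))"
      by (simp only: sum_Basis_complex_vec Re_sum sum_distrib_left)
    also have "(\<Sum>k\<in>UNIV. \<Sum>n\<in>?S. \<Sum>m\<in>?S. G n m * (\<phi> m x $ k * cnj (\<phi> n x $ k)))
      = (\<Sum>n\<in>?S. \<Sum>k\<in>UNIV. \<Sum>m\<in>?S. G n m * (\<phi> m x $ k * cnj (\<phi> n x $ k)))"
      by (rule sum.swap)
    also have "\<dots> = (\<Sum>n\<in>?S. \<Sum>m\<in>?S. \<Sum>k\<in>UNIV. G n m * (\<phi> m x $ k * cnj (\<phi> n x $ k)))"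
      by (intro sum.cong refl sum.swap)
    finally show ?thesis unfolding hinner_def sum_distrib_left .
  qed
  finally show ?le using tr unfolding G_def by simp
qed

text \<open>Passes from the Borel measure of the theorem to the completed Lebesgue measure behind
  \<open>absolutely_integrable_on\<close>.\<close>

lemma set_integrable_lborel_imp_absolutely_integrable:
  fixes f :: "'a::euclidean_space \<Rightarrow> 'b::euclidean_space"
  assumes "set_integrable lborel S f"
  shows "f absolutely_integrable_on S"
  using assms unfolding set_integrable_def
  by (subst integrable_completion) (auto dest: borel_measurable_integrable)

text \<open>\<open>\<psi> n\<close> is the derivative of \<open>\<phi> n\<close> in the sense of
  \<open>abs_cont\<close>. With \<open>a\<close> and \<open>\<psi> n\<close> merely in L1 the
  kinetic energy can be infinite, hence nonnegative integrals on both sides.\<close>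

theorem theorem6p2:
  fixes a :: "real \<Rightarrow> real"
    and N :: nat
    and \<phi> \<psi> :: "nat \<Rightarrow> real \<Rightarrow> complex^'m"
  assumes a_L1: "set_integrable lborel {0..2*pi} a"
    and flux: "(LINT x:{0..2*pi}|lborel. a x) / (2*pi) \<notin> \<int>"
    and meas: "\<And>n j. n \<in> {1..N} \<Longrightarrow> (\<lambda>x. \<phi> n x $ j) \<in> borel_measurable lborel"
    and L2: "\<And>n. n \<in> {1..N} \<Longrightarrow> set_integrable lborel {0..2*pi} (\<lambda>x. (norm (\<phi> n x))\<^sup>2)"
    and orthonormal: "\<And>n m. n \<in> {1..N} \<Longrightarrow> m \<in> {1..N} \<Longrightarrow>
        (LINT x:{0..2*pi}|lborel. (\<Sum>j\<in>UNIV. \<phi> n x $ j * cnj (\<phi> m x $ j)))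
          = (if n = m then 1 else 0)"
    and periodic: "\<And>n x. n \<in> {1..N} \<Longrightarrow> \<phi> n (x + 2*pi) = \<phi> n x"
    and deriv_L1: "\<And>n j. n \<in> {1..N} \<Longrightarrow> set_integrable lborel {0..2*pi} (\<lambda>x. \<psi> n x $ j)"
    and abs_cont: "\<And>n j x. n \<in> {1..N} \<Longrightarrow> x \<in> {0..2*pi} \<Longrightarrow>
        \<phi> n x $ j = \<phi> n 0 $ j + (LINT t:{0..x}|lborel. \<psi> n t $ j)"
  shows "(\<integral>\<^sup>+ x\<in>{0..2*pi}. ennreal (Re (trace (Umat N \<phi> x x ** Umat N \<phi> x x ** Umat N \<phi> x x))) \<partial>lborel)
         \<le> ennreal ((Kconst ((LINT x:{0..2*pi}|lborel. a x) / (2*pi)))\<^sup>2) *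
           (\<Sum>n\<in>{1..N}. \<Sum>j\<in>UNIV.
              \<integral>\<^sup>+ x\<in>{0..2*pi}. ennreal ((cmod (\<i> * \<psi> n x $ j - complex_of_real (a x) * \<phi> n x $ j))\<^sup>2) \<partial>lborel)"
proof -
  let ?I = "{0..2*pi}" and ?S = "{1..N}"
  define M where "M = restrict_space lborel ?I"
  define A where "A n t = (\<chi> j. \<i> * \<psi> n t $ j - complex_of_real (a t) * \<phi> n t $ j)" for n t
  define G where "G n m = (\<integral>t. hinner (A n t) (A m t) \<partial>M)" for n m
  define R where "R x = Re (\<Sum>n\<in>?S. \<Sum>m\<in>?S. G n m * hinner (\<phi> m x) (\<phi> n x))" for x
  let ?K = "Kconst (integral ?I a / (2*pi))"
  let ?U = "\<lambda>x. Umat N \<phi> x x"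
  have int_a: "(LINT x:?I|lborel. a x) = integral ?I a"
    by (rule set_borel_integral_eq_integral(2)[OF a_L1])
  have fluxI: "integral ?I a / (2*pi) \<notin> \<int>" using flux unfolding int_a .
  have M_integrable: "integrable M f" if "set_integrable lborel ?I f"
    for f :: "real \<Rightarrow> 'c::euclidean_space"
    using that by (simp add: M_def set_integrable_def integrable_restrict_space)
  have M_integral: "(LINT x:?I|lborel. f x) = integral\<^sup>L M f" for f :: "real \<Rightarrow> complex"
    by (simp add: M_def set_lebesgue_integral_def integral_restrict_space)
  have M_nn: "(\<integral>\<^sup>+ x\<in>?I. f x \<partial>lborel) = (\<integral>\<^sup>+ x. f x \<partial>M)" for f
    by (simp add: M_def nn_integral_restrict_space)
  have meas\<phi>: "(\<lambda>x. \<phi> n x $ j) \<in> borel_measurable M" if "n \<in> ?S" for n j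
    unfolding M_def using meas[OF that] by (rule measurable_restrict_space1)
  have measA: "(\<lambda>x. A n x $ j) \<in> borel_measurable M" if "n \<in> ?S" for n j
  proof -
    have [measurable]: "(\<lambda>x. \<psi> n x $ j) \<in> borel_measurable M" "a \<in> borel_measurable M"
      using M_integrable[OF deriv_L1[OF that]] M_integrable[OF a_L1] by auto
    note [measurable] = meas\<phi>[OF that]
    show ?thesis unfolding A_def by simp
  qed
  let ?E = "\<lambda>n j. \<integral>\<^sup>+ x. ennreal ((cmod (A n x $ j))\<^sup>2) \<partial>M"
  have "(\<integral>\<^sup>+ x. ennreal (Re (trace (?U x ** ?U x ** ?U x))) \<partial>M) \<le> ennreal (?K\<^sup>2) * (\<Sum>n\<in>?S. \<Sum>j\<in>UNIV. ?E n j)"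
  \<comment> \<open>With an infinite energy the right side is infinite. Positivity of
    \<open>Kconst\<close> matters there, since 0 times infinity is 0 in
    \<open>ennreal\<close>.\<close>
  proof (cases "\<exists>n\<in>?S. \<exists>j. ?E n j = \<infinity>")
    case True
    then have E: "(\<Sum>n\<in>?S. \<Sum>j\<in>UNIV. ?E n j) = \<infinity>" by auto
    show ?thesis unfolding E using Kconst_pos[OF fluxI] by (simp add: ennreal_mult_top)
  next
    case False
    have L2\<phi>: "integrable M (\<lambda>t. (norm (\<phi> n t))\<^sup>2)" if "n \<in> ?S" for n
      by (rule M_integrable[OF L2[OF that]])
    have L2Aj: "integrable M (\<lambda>t. (cmod (A n t $ j))\<^sup>2)" if "n \<in> ?S" for n j
      using False that measA[OF that, of j, measurable]
      by (intro integrableI_nonneg) (auto simp: less_top[symmetric])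
    have L2A: "integrable M (\<lambda>t. (norm (A n t))\<^sup>2)" if "n \<in> ?S" for n
      unfolding norm2_eq_sum by (intro Bochner_Integration.integrable_sum L2Aj that)
    have orth: "(\<integral>t. hinner (\<phi> n t) (\<phi> m t) \<partial>M) = (if n = m then 1 else 0)" if "n \<in> ?S" "m \<in> ?S" for n m
      using orthonormal[OF that] unfolding M_integral hinner_def .
    have AC: "((\<lambda>s. \<psi> n s $ j) has_integral (\<phi> n t $ j - \<phi> n 0 $ j)) {0..t}"
      if n: "n \<in> ?S" and t: "t \<in> ?I" for n j t
    proof -
      have s: "set_integrable lborel {0..t} (\<lambda>s. \<psi> n s $ j)"
        by (rule set_integrable_subset[OF deriv_L1[OF n]]) (use t in auto)
      show ?thesis
        using set_borel_integral_eq_integral[OF s] abs_cont[OF n t, of j] by (simp add: has_integral_iff)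
    qed
    have per: "\<phi> n (2*pi) = \<phi> n 0" if "n \<in> ?S" for n using periodic[OF that, of 0] by simp
    have bound: "0 \<le> Re (trace (?U x ** ?U x ** ?U x)) \<and> Re (trace (?U x ** ?U x ** ?U x)) \<le> ?K\<^sup>2 * R x"
      if x: "x \<in> ?I" for x
    proof -
      have "A n t $ j = \<i> * \<psi> n t $ j - complex_of_real (a t) * \<phi> n t $ j" for n t j by (simp add: A_def)
      then show ?thesis
        unfolding R_def G_def M_def
        by (intro conjI trace_cube_le[where A=A and a=a and \<psi>=\<psi>] fluxI AC per orth[unfolded M_def] meas\<phi>[unfolded M_def]
            measA[unfolded M_def] L2\<phi>[unfolded M_def] L2A[unfolded M_def] x
            set_integrable_lborel_imp_absolutely_integrable a_L1 deriv_L1)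
    qed
    have int\<phi>: "integrable M (\<lambda>t. hinner (\<phi> n t) (\<phi> m t))" if "n \<in> ?S" "m \<in> ?S" for n m
      by (rule gram_integral(1)[of ?S]; (intro meas\<phi> L2\<phi> that)?; assumption?)
    have hbi: "has_bochner_integral M (\<lambda>x. \<Sum>n\<in>?S. \<Sum>m\<in>?S. G n m * hinner (\<phi> m x) (\<phi> n x))
        (\<Sum>n\<in>?S. \<Sum>m\<in>?S. G n m * (\<integral>x. hinner (\<phi> m x) (\<phi> n x) \<partial>M))"
      by (intro has_bochner_integral_sum has_bochner_integral_mult_right has_bochner_integral_integrable int\<phi>)
    note intC = integrable.intros[OF hbi]
    from intC have intR: "integrable M R" unfolding R_def by (rule integrable_Re)
    \<comment> \<open>Orthonormality is used a second time, now in \<open>x\<close>: only the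
      diagonal entries \<open>G n n\<close>, the kinetic energies, survive.\<close>
    have "integral\<^sup>L M R = Re (\<Sum>n\<in>?S. \<Sum>m\<in>?S. G n m * (\<integral>x. hinner (\<phi> m x) (\<phi> n x) \<partial>M))"
      unfolding R_def integral_Re[OF intC] has_bochner_integral_integral_eq[OF hbi] ..
    also have "\<dots> = Re (\<Sum>n\<in>?S. \<Sum>m\<in>?S. G n m * (if m = n then 1 else 0))"
      by (intro arg_cong[where f=Re] sum.cong refl arg_cong2[where f="(*)"] orth)
    also have "\<dots> = (\<Sum>n\<in>?S. Re (G n n))" by (simp add: if_distrib cong: if_cong)
    also have "\<dots> = (\<Sum>n\<in>?S. \<Sum>j\<in>UNIV. \<integral>t. (cmod (A n t $ j))\<^sup>2 \<partial>M)"
      unfolding G_def hinner_self integral_complex_of_real Re_complex_of_real norm2_eq_sum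
      by (intro sum.cong refl Bochner_Integration.integral_sum L2Aj)
    finally have R: "integral\<^sup>L M R = (\<Sum>n\<in>?S. \<Sum>j\<in>UNIV. \<integral>t. (cmod (A n t $ j))\<^sup>2 \<partial>M)" .
    have sp: "space M = ?I" by (simp add: M_def space_restrict_space)
    have "(\<integral>\<^sup>+ x. ennreal (Re (trace (?U x ** ?U x ** ?U x))) \<partial>M) \<le> (\<integral>\<^sup>+ x. ennreal (?K\<^sup>2 * R x) \<partial>M)"
      by (intro nn_integral_mono ennreal_leI) (use bound sp in auto)
    \<comment> \<open>The integrand is nonnegative because it dominates a nonnegative trace.\<close>
    also have "\<dots> = ennreal (\<integral>x. ?K\<^sup>2 * R x \<partial>M)"
      by (intro nn_integral_eq_integral integrable_mult_right intR AE_I2) (use bound sp in \<open>auto intro: order_trans\<close>)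
    also have "\<dots> = ennreal (?K\<^sup>2) * ennreal (integral\<^sup>L M R)"
      by (simp add: ennreal_mult')
    also have "ennreal (integral\<^sup>L M R) = (\<Sum>n\<in>?S. \<Sum>j\<in>UNIV. ?E n j)"
      unfolding R by (simp add: nn_integral_eq_integral L2Aj sum_nonneg sum_ennreal[symmetric] del: sum_ennreal)
    finally show ?thesis .
  qed
  then show ?thesis unfolding M_nn int_a by (simp add: A_def)
qed

end
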